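(* Let $G=G(\mathsf{x};\bar\lambda,\lambda,\bar\rho,\rho)$ be the generating function of labeled plane binary trees by left ascents, left descents, right ascents and right descents. Then $$G=\sum_{n\ge 1}\ \sum_{\alpha\vDash n}(\bar\lambda\bar\rho\,G+\bar\lambda+\bar\rho)^{n-\ell(\alpha)}(\lambda\rho\,G+\lambda+\rho)^{\ell(\alpha)-1}\,r_\alpha,$$ where the inner sum is over all compositions $\alpha$ of $n$, $\ell(\alpha)$ is the number of parts of $\alpha$, and $r_\alpha$ is the ribbon Schur function indexed by $\alpha$.
   Context: A (plane binary) tree is a rooted tree in which every node has at most one left child and at most one right child (it may have only one of the two), and no other children. A labeled tree is a tree whose nodes are labeled with positive integers, repetitions allowed; $\mathcal{T}^{\ell}_n$ is the set of labeled trees on $n\ge 1$ nodes. Write $v^\ell$ for the label of a node $v$. If $v$ is the left child of $w$, the edge between them is a left ascent if $v^\ell\le w^\ell$ and a left descent otherwise. If $w$ is the right child of $v$, the edge between them is a right ascent if $v^\ell\le w^\ell$ and a right descent otherwise. Let $\mathrm{lasc}(T),\mathrm{ldes}(T),\mathrm{rasc}(T),\mathrm{rdes}(T)$ be the numbers of left ascents, left descents, right ascents and right descents of $T$. Let $\mathsf{x}=\{x_1,x_2,\dots\}$ be commuting indeterminates, $\mathsf{x}^T=\prod_{v\in T}x_{v^\ell}$, and let $\bar\lambda,\lambda,\bar\rho,\rho$ be commuting indeterminates. Define $$G=\sum_{n\ge 1}\sum_{T\in\mathcal{T}^\ell_n}\bar\lambda^{\mathrm{lasc}(T)}\lambda^{\mathrm{ldes}(T)}\bar\rho^{\,\mathrm{rasc}(T)}\rho^{\,\mathrm{rdes}(T)}\,\mathsf{x}^T.$$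 For a composition $\alpha=(\alpha_1,\dots,\alpha_k)\vDash n$, let $\mathrm{set}(\alpha)=\{\alpha_1,\alpha_1+\alpha_2,\dots,\alpha_1+\cdots+\alpha_{k-1}\}\subseteq[n-1]$. The ribbon Schur function is $r_\alpha=\sum_w x_{w_1}x_{w_2}\cdots x_{w_n}$, summed over all words $w=w_1\cdots w_n$ of positive integers with $\{i: w_i>w_{i+1}\}=\mathrm{set}(\alpha)$. *)

theory Defs
  imports
    "HOL-Analysis.Infinite_Sum"
    "HOL-Library.Poly_Mapping"
    "HOL-Library.Tree"
begin

section \<open>Formal power series in arbitrarily many commuting indeterminates\<close>

text \<open>
  A series assigns a coefficient to every monomial. A monomial is a finitely supported exponent
  vector, so that \<^term>\<open>0\<close> is the monomial 1 and addition is the product of monomials. The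
  series may involve infinitely many indeterminates and have unbounded degree.
\<close>

typedef ('v, 'c) mfps = "UNIV :: (('v \<Rightarrow>\<^sub>0 nat) \<Rightarrow> 'c) set"
  morphisms coeff Mfps
  by simp

lemma coeff_Mfps [simp]: "coeff (Mfps f) m = f m"
  by (simp add: Mfps_inverse)

lemma mfps_eqI: "(\<And>m. coeff f m = coeff g m) \<Longrightarrow> f = g"
  by (metis coeff_inject ext)

definition splits :: "('v \<Rightarrow>\<^sub>0 nat) \<Rightarrow> (('v \<Rightarrow>\<^sub>0 nat) \<times> ('v \<Rightarrow>\<^sub>0 nat)) set" where
  "splits m = {(a, b). a + b = m}"

lemma finite_splits [simp]: "finite (splits m)"
proof -
  let ?F = "{f. \<forall>v. (v \<in> Poly_Mapping.keys m \<longrightarrow> f v \<in> {0..Poly_Mapping.lookup m v})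
      \<and> (v \<notin> Poly_Mapping.keys m \<longrightarrow> f v = 0)}"
  have "finite (\<Union>v\<in>Poly_Mapping.keys m. {0..Poly_Mapping.lookup m v})" by simp
  then have "finite {f. \<forall>v. (v \<in> Poly_Mapping.keys m \<longrightarrow> f v \<in> (\<Union>v\<in>Poly_Mapping.keys m. {0..Poly_Mapping.lookup m v}))
      \<and> (v \<notin> Poly_Mapping.keys m \<longrightarrow> f v = (0::nat))}"
    by (rule finite_set_of_finite_funs[rotated]) simp
  then have "finite ?F" by (rule rev_finite_subset) auto
  then have "finite ((\<lambda>p. (Poly_Mapping.lookup (fst p), Poly_Mapping.lookup (snd p))) ` splits m)"
    by (intro finite_subset[OF _ finite_cartesian_product[of ?F ?F]])
       (auto simp: splits_def lookup_add in_keys_iff)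
  moreover have "inj_on (\<lambda>p. (Poly_Mapping.lookup (fst p), Poly_Mapping.lookup (snd p))) (splits m)"
    by (auto simp: inj_on_def lookup_inject)
  ultimately show ?thesis by (rule finite_imageD)
qed

instantiation mfps :: (type, comm_ring_1) comm_ring_1
begin

definition zero_mfps :: "('a, 'b) mfps" where
  "0 = Mfps (\<lambda>m. 0)"

definition one_mfps :: "('a, 'b) mfps" where
  "1 = Mfps (\<lambda>m. if m = 0 then 1 else 0)"

definition plus_mfps :: "('a, 'b) mfps \<Rightarrow> ('a, 'b) mfps \<Rightarrow> ('a, 'b) mfps" where
  "f + g = Mfps (\<lambda>m. coeff f m + coeff g m)"

definition uminus_mfps :: "('a, 'b) mfps \<Rightarrow> ('a, 'b) mfps" where
  "- f = Mfps (\<lambda>m. - coeff f m)"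

definition minus_mfps :: "('a, 'b) mfps \<Rightarrow> ('a, 'b) mfps \<Rightarrow> ('a, 'b) mfps" where
  "f - g = Mfps (\<lambda>m. coeff f m - coeff g m)"

definition times_mfps :: "('a, 'b) mfps \<Rightarrow> ('a, 'b) mfps \<Rightarrow> ('a, 'b) mfps" where
  "f * g = Mfps (\<lambda>m. \<Sum>(a, b)\<in>splits m. coeff f a * coeff g b)"

instance
proof
  fix f g h :: "('a, 'b) mfps"
  note defs = zero_mfps_def one_mfps_def plus_mfps_def uminus_mfps_def minus_mfps_def times_mfps_def
  show "f + g + h = f + (g + h)" "f + g = g + f" "0 + f = f" "- f + f = 0" "f - g = f + - g"
    by (simp_all add: defs mfps_eqI algebra_simps)
  show "f * g * h = f * (g * h)"
  proof (rule mfps_eqI)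
    fix m
    have "coeff (f * g * h) m =
        (\<Sum>p\<in>splits m. \<Sum>q\<in>splits (fst p). coeff f (fst q) * coeff g (snd q) * coeff h (snd p))"
      by (simp add: defs case_prod_beta sum_distrib_right)
    also have "\<dots> = (\<Sum>(p, q)\<in>Sigma (splits m) (\<lambda>p. splits (fst p)).
        coeff f (fst q) * coeff g (snd q) * coeff h (snd p))"
      by (simp add: sum.Sigma)
    also have "\<dots> = (\<Sum>(p, q)\<in>Sigma (splits m) (\<lambda>p. splits (snd p)).
        coeff f (fst p) * (coeff g (fst q) * coeff h (snd q)))"
      by (rule sum.reindex_bij_witness
          [of _ "\<lambda>((a, b), (c, d)). ((a + c, d), (a, c))" "\<lambda>((a, b), (c, d)). ((c, d + b), (d, b))"])
         (auto simp: splits_def algebra_simps)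
    also have "\<dots> = (\<Sum>p\<in>splits m. \<Sum>q\<in>splits (snd p).
        coeff f (fst p) * (coeff g (fst q) * coeff h (snd q)))"
      by (simp add: sum.Sigma)
    also have "\<dots> = coeff (f * (g * h)) m"
      by (simp add: defs case_prod_beta sum_distrib_left)
    finally show "coeff (f * g * h) m = coeff (f * (g * h)) m" .
  qed
  show "f * g = g * f"
  proof (rule mfps_eqI)
    fix m
    show "coeff (f * g) m = coeff (g * f) m"
      unfolding defs coeff_Mfps
      by (rule sum.reindex_bij_witness[of _ prod.swap prod.swap])
         (auto simp: splits_def algebra_simps)
  qed
  show "1 * f = f"
  proof (rule mfps_eqI)
    fix m
    have "coeff (1 * f) m = (\<Sum>(a, b)\<in>splits m. (if a = 0 then 1 else 0) * coeff f b)"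
      by (simp add: defs)
    also have "\<dots> = (\<Sum>(a, b)\<in>{(0 :: 'a \<Rightarrow>\<^sub>0 nat, m)}. (if a = 0 then 1 else 0) * coeff f b)"
      by (rule sum.mono_neutral_right[OF finite_splits]) (auto simp: splits_def split: if_splits)
    finally show "coeff (1 * f) m = coeff f m" by simp
  qed
  show "(f + g) * h = f * h + g * h"
    by (simp add: defs mfps_eqI case_prod_beta sum.distrib algebra_simps)
  have "coeff (0 :: ('a, 'b) mfps) 0 \<noteq> coeff 1 0" by (simp add: defs)
  then show "(0 :: ('a, 'b) mfps) \<noteq> 1" by auto
qed

end

lemma coeff_zero [simp]: "coeff 0 m = 0"
  and coeff_one: "coeff 1 m = (if m = 0 then 1 else 0)"
  and coeff_add [simp]: "coeff (f + g) m = coeff f m + coeff g m"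
  and coeff_uminus [simp]: "coeff (- f) m = - coeff f m"
  and coeff_diff [simp]: "coeff (f - g) m = coeff f m - coeff g m"
  and coeff_mult: "coeff (f * g) m = (\<Sum>(a, b)\<in>splits m. coeff f a * coeff g b)"
  by (simp_all add: zero_mfps_def one_mfps_def plus_mfps_def uminus_mfps_def minus_mfps_def
      times_mfps_def)

lemma coeff_sum: "coeff (sum f A) m = (\<Sum>i\<in>A. coeff (f i) m)"
  by (induction A rule: infinite_finite_induct) auto

definition monom :: "('v \<Rightarrow>\<^sub>0 nat) \<Rightarrow> ('v, 'c::comm_ring_1) mfps" where
  "monom a = Mfps (\<lambda>m. if m = a then 1 else 0)"

definition Var :: "'v \<Rightarrow> ('v, 'c::comm_ring_1) mfps" where
  "Var v = monom (Poly_Mapping.single v 1)"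

lemma coeff_monom: "coeff (monom a) m = (if m = a then 1 else 0)"
  by (simp add: monom_def)

lemma monom_0: "monom 0 = 1"
  by (simp add: monom_def one_mfps_def)

lemma monom_mult: "monom a * monom b = monom (a + b)"
proof (rule mfps_eqI)
  fix m
  have "coeff (monom a * monom b :: ('a, 'b) mfps) m =
      (\<Sum>p\<in>splits m. if p = (a, b) then 1 else 0)"
    unfolding coeff_mult by (intro sum.cong) (auto simp: coeff_monom split: if_splits)
  then show "coeff (monom a * monom b :: ('a, 'b) mfps) m = coeff (monom (a + b)) m"
    by (simp add: coeff_monom) (simp add: splits_def eq_commute)
qed

text \<open>
  The topology of coefficientwise convergence, each coefficient being discrete: a net of series
  converges iff every coefficient is eventually constant.
\<close>

instantiation mfps :: (type, type) t2_space
begin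

definition open_mfps :: "('a, 'b) mfps set \<Rightarrow> bool" where
  "open U \<longleftrightarrow> (\<forall>f\<in>U. \<exists>M. finite M \<and> {g. \<forall>m\<in>M. coeff g m = coeff f m} \<subseteq> U)"

instance
proof
  show "open (UNIV :: ('a, 'b) mfps set)"
    by (auto simp: open_mfps_def)
next
  fix S T :: "('a, 'b) mfps set"
  assume S: "open S" and T: "open T"
  show "open (S \<inter> T)"
    unfolding open_mfps_def
  proof
    fix f assume f: "f \<in> S \<inter> T"
    obtain M N where "finite M" "{g. \<forall>m\<in>M. coeff g m = coeff f m} \<subseteq> S"
        "finite N" "{g. \<forall>m\<in>N. coeff g m = coeff f m} \<subseteq> T"
      using S[unfolded open_mfps_def, THEN bspec, of f] T[unfolded open_mfps_def, THEN bspec, of f] f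
      by auto
    then show "\<exists>M. finite M \<and> {g. \<forall>m\<in>M. coeff g m = coeff f m} \<subseteq> S \<inter> T"
      by (intro exI[of _ "M \<union> N"]) auto
  qed
next
  fix K :: "('a, 'b) mfps set set"
  assume K: "\<forall>S\<in>K. open S"
  show "open (\<Union>K)"
    unfolding open_mfps_def
  proof
    fix f assume "f \<in> \<Union>K"
    then obtain S where S: "S \<in> K" "f \<in> S" by blast
    with K have "open S" by blast
    from this[unfolded open_mfps_def, THEN bspec, OF S(2)]
    obtain M where "finite M" "{g. \<forall>m\<in>M. coeff g m = coeff f m} \<subseteq> S"
      by blast
    with S show "\<exists>M. finite M \<and> {g. \<forall>m\<in>M. coeff g m = coeff f m} \<subseteq> \<Union>K"
      by blast
  qed
next
  fix f g :: "('a, 'b) mfps"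
  assume "f \<noteq> g"
  then obtain m where m: "coeff f m \<noteq> coeff g m" using mfps_eqI by blast
  have op: "open {k. coeff k m = coeff h m}" for h :: "('a, 'b) mfps"
    unfolding open_mfps_def by (intro ballI exI[of _ "{m}"]) auto
  show "\<exists>U V. open U \<and> open V \<and> f \<in> U \<and> g \<in> V \<and> U \<inter> V = {}"
    using m op[of f] op[of g]
    by (intro exI[of _ "{k. coeff k m = coeff f m}"] exI[of _ "{k. coeff k m = coeff g m}"]) auto
qed

end

lemma tendsto_mfps_iff:
  "(f \<longlongrightarrow> l) F \<longleftrightarrow> (\<forall>m. \<forall>\<^sub>F x in F. coeff (f x) m = coeff l m)"
proof
  assume L: "(f \<longlongrightarrow> l) F"
  show "\<forall>m. \<forall>\<^sub>F x in F. coeff (f x) m = coeff l m"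
  proof
    fix m
    have "open {g. coeff g m = coeff l m}"
      unfolding open_mfps_def by (intro ballI exI[of _ "{m}"]) auto
    from topological_tendstoD[OF L this] show "\<forall>\<^sub>F x in F. coeff (f x) m = coeff l m" by simp
  qed
next
  assume R: "\<forall>m. \<forall>\<^sub>F x in F. coeff (f x) m = coeff l m"
  show "(f \<longlongrightarrow> l) F"
  proof (rule topological_tendstoI)
    fix S assume S: "open S" "l \<in> S"
    from S(1)[unfolded open_mfps_def, THEN bspec, OF S(2)]
    obtain M where M: "finite M" "{g. \<forall>m\<in>M. coeff g m = coeff l m} \<subseteq> S"
      by blast
    have "\<forall>\<^sub>F x in F. \<forall>m\<in>M. coeff (f x) m = coeff l m"
      using R by (intro eventually_ball_finite[OF M(1)]) auto
    then show "\<forall>\<^sub>F x in F. f x \<in> S"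
      by eventually_elim (use M in auto)
  qed
qed

instance mfps :: (type, comm_ring_1) topological_comm_monoid_add
proof
  fix f g :: "('a, 'b) mfps"
  have 1: "((\<lambda>x. fst x) \<longlongrightarrow> f) (nhds f \<times>\<^sub>F nhds g)"
    and 2: "((\<lambda>x. snd x) \<longlongrightarrow> g) (nhds f \<times>\<^sub>F nhds g)"
    by (rule filterlim_fst, rule filterlim_snd)
  show "LIM x (nhds f \<times>\<^sub>F nhds g). fst x + snd x :> nhds (f + g)"
    unfolding tendsto_mfps_iff
  proof
    fix m
    from 1 2 have "\<forall>\<^sub>F x in nhds f \<times>\<^sub>F nhds g. coeff (fst x) m = coeff f m"
      "\<forall>\<^sub>F x in nhds f \<times>\<^sub>F nhds g. coeff (snd x) m = coeff g m"
      by (auto simp: tendsto_mfps_iff)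
    then show "\<forall>\<^sub>F x in nhds f \<times>\<^sub>F nhds g. coeff (fst x + snd x) m = coeff (f + g) m"
      by eventually_elim simp
  qed
qed

lemma has_sum_mfpsI:
  fixes f :: "'i \<Rightarrow> ('v, 'c::comm_ring_1) mfps"
  assumes "\<And>m. finite {i \<in> A. coeff (f i) m \<noteq> 0}"
    and "\<And>m. coeff s m = (\<Sum>i | i \<in> A \<and> coeff (f i) m \<noteq> 0. coeff (f i) m)"
  shows "(f has_sum s) A"
  unfolding has_sum_def tendsto_mfps_iff
proof
  fix m
  show "\<forall>\<^sub>F x in finite_subsets_at_top A. coeff (sum f x) m = coeff s m"
    unfolding eventually_finite_subsets_at_top
  proof (intro exI[of _ "{i \<in> A. coeff (f i) m \<noteq> 0}"] conjI allI impI)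
    fix Y assume Y: "finite Y \<and> {i \<in> A. coeff (f i) m \<noteq> 0} \<subseteq> Y \<and> Y \<subseteq> A"
    have "(\<Sum>i\<in>Y. coeff (f i) m) = (\<Sum>i | i \<in> A \<and> coeff (f i) m \<noteq> 0. coeff (f i) m)"
      using Y by (intro sum.mono_neutral_right) auto
    then show "coeff (sum f Y) m = coeff s m"
      by (simp add: coeff_sum assms)
  qed (use assms in auto)
qed

lemma
  fixes f :: "'i \<Rightarrow> ('v, 'c::comm_ring_1) mfps"
  assumes "\<And>m. finite {i \<in> A. coeff (f i) m \<noteq> 0}"
  shows summable_on_mfpsI: "f summable_on A"
    and coeff_infsum: "coeff (infsum f A) m = (\<Sum>i | i \<in> A \<and> coeff (f i) m \<noteq> 0. coeff (f i) m)"
proof -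
  have *: "(f has_sum Mfps (\<lambda>m. \<Sum>i | i \<in> A \<and> coeff (f i) m \<noteq> 0. coeff (f i) m)) A"
    by (rule has_sum_mfpsI) (use assms in auto)
  show "f summable_on A" using * by (auto simp: summable_on_def)
  show "coeff (infsum f A) m = (\<Sum>i | i \<in> A \<and> coeff (f i) m \<noteq> 0. coeff (f i) m)"
    using infsumI[OF *] by simp
qed


section \<open>Labeled plane binary trees\<close>

text \<open>
  In \<^typ>\<open>'a tree\<close> the constructor \<^const>\<open>Leaf\<close> is the empty tree, i.e. an absent child; the
  nodes of a plane binary tree are exactly the \<^const>\<open>Node\<close>s, and \<^const>\<open>size\<close> counts them.
\<close>

definition labeled_trees :: "nat \<Rightarrow> nat tree set" where
  "labeled_trees n = {T. size T = n \<and> (\<forall>a\<in>set_tree T. 0 < a)}"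

fun lasc :: "nat tree \<Rightarrow> nat" where
  "lasc Leaf = 0"
| "lasc (Node l a r) =
     (case l of Leaf \<Rightarrow> 0 | Node _ b _ \<Rightarrow> if b \<le> a then 1 else 0) + lasc l + lasc r"

fun ldes :: "nat tree \<Rightarrow> nat" where
  "ldes Leaf = 0"
| "ldes (Node l a r) =
     (case l of Leaf \<Rightarrow> 0 | Node _ b _ \<Rightarrow> if b \<le> a then 0 else 1) + ldes l + ldes r"

fun rasc :: "nat tree \<Rightarrow> nat" where
  "rasc Leaf = 0"
| "rasc (Node l a r) =
     (case r of Leaf \<Rightarrow> 0 | Node _ b _ \<Rightarrow> if a \<le> b then 1 else 0) + rasc l + rasc r"

fun rdes :: "nat tree \<Rightarrow> nat" where
  "rdes Leaf = 0"
| "rdes (Node l a r) =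
     (case r of Leaf \<Rightarrow> 0 | Node _ b _ \<Rightarrow> if a \<le> b then 0 else 1) + rdes l + rdes r"

text \<open>
  All indeterminates live in one power series ring. Only the \<open>X i\<close> with \<open>i \<ge> 1\<close> occur.
\<close>

datatype indet = X nat | Lam_bar | Lam | Rho_bar | Rho

abbreviation x_var :: "nat \<Rightarrow> (indet, 'c::comm_ring_1) mfps" where "x_var i \<equiv> Var (X i)"
abbreviation lam_bar :: "(indet, 'c::comm_ring_1) mfps" where "lam_bar \<equiv> Var Lam_bar"
abbreviation lam :: "(indet, 'c::comm_ring_1) mfps" where "lam \<equiv> Var Lam"
abbreviation rho_bar :: "(indet, 'c::comm_ring_1) mfps" where "rho_bar \<equiv> Var Rho_bar"
abbreviation rho :: "(indet, 'c::comm_ring_1) mfps" where "rho \<equiv> Var Rho"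

definition x_word :: "nat list \<Rightarrow> (indet, 'c::comm_ring_1) mfps" where
  "x_word w = (\<Prod>i\<leftarrow>w. x_var i)"

definition x_tree :: "nat tree \<Rightarrow> (indet, 'c::comm_ring_1) mfps" where
  "x_tree T = x_word (inorder T)"

definition tree_weight :: "nat tree \<Rightarrow> (indet, 'c::comm_ring_1) mfps" where
  "tree_weight T = lam_bar ^ lasc T * lam ^ ldes T * rho_bar ^ rasc T * rho ^ rdes T * x_tree T"

definition tree_gf :: "(indet, 'c::comm_ring_1) mfps" where
  "tree_gf = (\<Sum>\<^sub>\<infinity>n\<in>{1..}. \<Sum>\<^sub>\<infinity>T\<in>labeled_trees n. tree_weight T)"


section \<open>Compositions and ribbon Schur functions\<close>

definition compositions :: "nat \<Rightarrow> nat list set" where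
  "compositions n = {\<alpha>. (\<forall>a\<in>set \<alpha>. 0 < a) \<and> sum_list \<alpha> = n}"

definition comp_set :: "nat list \<Rightarrow> nat set" where
  "comp_set \<alpha> = {sum_list (take i \<alpha>) | i. 1 \<le> i \<and> i < length \<alpha>}"

text \<open>Positions in words are counted from 1, hence the shift of the list indices.\<close>

definition word_des :: "nat list \<Rightarrow> nat set" where
  "word_des w = {i. 1 \<le> i \<and> i < length w \<and> w ! (i - 1) > w ! i}"

definition ribbon_words :: "nat list \<Rightarrow> nat list set" where
  "ribbon_words \<alpha> =
     {w. length w = sum_list \<alpha> \<and> (\<forall>a\<in>set w. 0 < a) \<and> word_des w = comp_set \<alpha>}"

definition ribbon :: "nat list \<Rightarrow> (indet, 'c::comm_ring_1) mfps" where
  "ribbon \<alpha> = (\<Sum>\<^sub>\<infinity>w\<in>ribbon_words \<alpha>. x_word w)"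


section \<open>All sums involved are well defined\<close>

lemma finite_compositions: "finite (compositions n)"
proof (rule finite_subset)
  have "length \<alpha> \<le> sum_list \<alpha>" if "\<forall>a\<in>set \<alpha>. 0 < a" for \<alpha> :: "nat list"
    using that by (induction \<alpha>) (auto simp: Suc_le_eq add_strict_increasing)
  then show "compositions n \<subseteq> {\<alpha>. set \<alpha> \<subseteq> {..n} \<and> length \<alpha> \<le> n}"
    by (auto simp: compositions_def intro: member_le_sum_list)
  show "finite {\<alpha>. set \<alpha> \<subseteq> {..n} \<and> length \<alpha> \<le> n}"
    by (rule finite_lists_length_le) simp
qed

lemma x_word_monom: "x_word w = monom (\<Sum>i\<leftarrow>w. Poly_Mapping.single (X i) 1)"
  by (induction w) (simp_all add: x_word_def monom_0 Var_def monom_mult)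

lemma lookup_word: "Poly_Mapping.lookup (\<Sum>i\<leftarrow>w. Poly_Mapping.single (X i) (1::nat)) (X j) = count_list w j"
  by (induction w) (auto simp: lookup_add lookup_single when_def)

lemma Var_power: "Var v ^ k = monom (Poly_Mapping.single v k)"
  by (induction k) (simp_all add: monom_0 Var_def monom_mult flip: single_add)

lemma finite_trees: "finite A \<Longrightarrow> finite {T :: 'a tree. size T \<le> n \<and> set_tree T \<subseteq> A}"
proof (induction n)
  case (Suc n)
  let ?S = "{T. size T \<le> n \<and> set_tree T \<subseteq> A}"
  have "{T. size T \<le> Suc n \<and> set_tree T \<subseteq> A} \<subseteq>
      insert Leaf ((\<lambda>(l, a, r). Node l a r) ` (?S \<times> A \<times> ?S))"
  proof
    fix T assume "T \<in> {T. size T \<le> Suc n \<and> set_tree T \<subseteq> A}"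
    then show "T \<in> insert Leaf ((\<lambda>(l, a, r). Node l a r) ` (?S \<times> A \<times> ?S))"
      by (cases T) (auto simp: image_iff)
  qed
  moreover have "finite (insert Leaf ((\<lambda>(l, a, r). Node l a r) ` (?S \<times> A \<times> ?S)))"
    using Suc by simp
  ultimately show ?case by (rule finite_subset)
qed simp

definition x_labels :: "(indet \<Rightarrow>\<^sub>0 nat) \<Rightarrow> nat set" where
  "x_labels m = {j. X j \<in> Poly_Mapping.keys m}"

lemma finite_x_labels: "finite (x_labels m)"
  unfolding x_labels_def by (rule finite_inverse_image[of "Poly_Mapping.keys m" X, simplified]) (auto simp: inj_def)

lemma word_bounds:
  assumes "\<And>j. Poly_Mapping.lookup m (X j) = count_list w j"
  shows "set w = x_labels m" "length w = (\<Sum>j\<in>x_labels m. Poly_Mapping.lookup m (X j))"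
proof -
  show *: "set w = x_labels m"
    using assms by (auto simp: x_labels_def in_keys_iff count_list_0_iff)
  have "length w = (\<Sum>j\<in>set w. count_list w j)" 
    by (simp add: sum_count_set)
  then show "length w = (\<Sum>j\<in>x_labels m. Poly_Mapping.lookup m (X j))"
    by (simp add: * assms)
qed

lemma coeff_x_word_nonzero:
  assumes "coeff (x_word w :: (indet, 'c::comm_ring_1) mfps) m \<noteq> 0"
  shows "Poly_Mapping.lookup m (X j) = count_list w j"
  using assms lookup_word by (auto simp: x_word_monom coeff_monom split: if_splits)

lemma coeff_tree_weight_nonzero:
  assumes "coeff (tree_weight T :: (indet, 'c::comm_ring_1) mfps) m \<noteq> 0"
  shows "Poly_Mapping.lookup m (X j) = count_list (inorder T) j"
  using assms lookup_word
  by (auto simp: tree_weight_def x_tree_def x_word_monom Var_power monom_mult coeff_monom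
      lookup_add lookup_single when_def split: if_splits)

lemma finite_words_coeff:
  "finite {w. coeff (x_word w :: (indet, 'c::comm_ring_1) mfps) m \<noteq> 0}"
  by (rule finite_subset[OF _ finite_lists_length_eq[OF finite_x_labels[of m],
        of "\<Sum>j\<in>x_labels m. Poly_Mapping.lookup m (X j)"]])
     (use word_bounds coeff_x_word_nonzero in blast)

lemma finite_trees_coeff:
  "finite {T. coeff (tree_weight T :: (indet, 'c::comm_ring_1) mfps) m \<noteq> 0}"
proof (rule finite_subset[OF _ finite_trees[OF finite_x_labels[of m],
        of "\<Sum>j\<in>x_labels m. Poly_Mapping.lookup m (X j)"]], rule subsetI)
  fix T assume "T \<in> {T. coeff (tree_weight T :: (indet, 'c) mfps) m \<noteq> 0}"
  then have "\<And>j. Poly_Mapping.lookup m (X j) = count_list (inorder T) j"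
    using coeff_tree_weight_nonzero by blast
  from word_bounds[OF this]
  show "T \<in> {T. size T \<le> (\<Sum>j\<in>x_labels m. Poly_Mapping.lookup m (X j)) \<and> set_tree T \<subseteq> x_labels m}"
    by simp
qed

lemma ribbon_summable:
  "(x_word :: _ \<Rightarrow> (indet, 'c::comm_ring_1) mfps) summable_on ribbon_words \<alpha>"
  by (rule summable_on_mfpsI, rule finite_subset[OF _ finite_words_coeff]) auto

lemma trees_of_size_summable:
  "(tree_weight :: _ \<Rightarrow> (indet, 'c::comm_ring_1) mfps) summable_on labeled_trees n"
  by (rule summable_on_mfpsI, rule finite_subset[OF _ finite_trees_coeff]) auto

lemma tree_gf_summable:
  "(\<lambda>n. \<Sum>\<^sub>\<infinity>T\<in>labeled_trees n. tree_weight T :: (indet, 'c::comm_ring_1) mfps) summable_on {1..}"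
proof (rule summable_on_mfpsI)
  fix m
  let ?S = "{T. coeff (tree_weight T :: (indet, 'c) mfps) m \<noteq> 0}"
  show "finite {n \<in> {1..}. coeff (\<Sum>\<^sub>\<infinity>T\<in>labeled_trees n. tree_weight T :: (indet, 'c) mfps) m \<noteq> 0}"
  proof (rule finite_subset)
    show "finite (size ` ?S)" using finite_trees_coeff by blast
    show "{n \<in> {1..}. coeff (\<Sum>\<^sub>\<infinity>T\<in>labeled_trees n. tree_weight T :: (indet, 'c) mfps) m \<noteq> 0}
        \<subseteq> size ` ?S"
    proof
      fix n assume "n \<in> {n \<in> {1..}.
          coeff (\<Sum>\<^sub>\<infinity>T\<in>labeled_trees n. tree_weight T :: (indet, 'c) mfps) m \<noteq> 0}"
      then have "(\<Sum>T | T \<in> labeled_trees n \<and> coeff (tree_weight T :: (indet, 'c) mfps) m \<noteq> 0.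
          coeff (tree_weight T :: (indet, 'c) mfps) m) \<noteq> 0"
        by (subst (asm) coeff_infsum)
           (auto intro: finite_subset[OF _ finite_trees_coeff])
      then obtain T where "T \<in> labeled_trees n" "T \<in> ?S"
        by (metis (mono_tags, lifting) mem_Collect_eq sum.neutral)
      then show "n \<in> size ` ?S" by (auto simp: labeled_trees_def)
    qed
  qed
qed

end

(*
  Let S k be the generating function of the trees whose root label is at most k. Splitting off the
  root k + 1 gives a recurrence S (k + 1) - S k = x_(k+1) p(S (k + 1)) q(S k) with p, q linear over
  G, so S k is mapped to S (k + 1) by a Moebius transformation. The two fixed points of that
  transformation do not depend on k, hence one fractional linear change of variable makes all
  steps affine: with lambda' = bar lambda,
      W k = (1 + lambda' G) S k / (1 + lambda G + (lambda' - lambda) S k)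
  satisfies the recurrence of the words with first letter at most k, where weak ascents are weighted
  by A = lambda' rho' G + lambda' + rho' and descents by D = lambda rho G + lambda + rho. Since S k
  tends to G, so does W k, and therefore G is the generating function of all weighted words, which
  are then grouped by descent set.
*)
theory Submission
  imports Defs
begin

section \<open>Infinite sums and limits of power series\<close>

text \<open>Only the finitely many factorizations of \<open>m\<close> matter, so a factor may be
  replaced by a truncation depending on \<open>m\<close>. Products of infinite sums and geometric
  series are reduced to finite sums in this way.\<close>

lemma coeff_mult_cong:
  assumes "\<And>a b. a + b = m \<Longrightarrow> coeff f a = coeff f' a"
    and "\<And>a b. a + b = m \<Longrightarrow> coeff g b = coeff g' b"
  shows "coeff (f * g) m = coeff (f' * g') m"
  unfolding coeff_mult using assms by (intro sum.cong) (auto simp: splits_def)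

lemma coeff_mult_eq_0:
  assumes "\<And>a b. a + b = m \<Longrightarrow> coeff f a = 0 \<or> coeff g b = 0"
  shows "coeff (f * g) m = 0"
  unfolding coeff_mult
proof (intro sum.neutral ballI, clarify)
  fix a b assume "(a, b) \<in> splits m"
  then have "coeff f a = 0 \<or> coeff g b = 0" by (intro assms) (simp add: splits_def)
  then show "coeff f a * coeff g b = 0" by auto
qed

text \<open>Coefficients are discrete, so each is constant on all large finite partial sums. One
  \<open>F\<close> serves a whole finite set \<open>M\<close> because a product involves all factors
  of a monomial at once.\<close>

lemma has_sum_mfpsD:
  fixes f :: "'i \<Rightarrow> ('v, 'c::comm_ring_1) mfps"
  assumes "(f has_sum s) A" and "finite M"
  shows "\<exists>F. finite F \<and> F \<subseteq> A \<and> (\<forall>m\<in>M. (\<forall>i\<in>A - F. coeff (f i) m = 0) \<and>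
    coeff s m = coeff (sum f F) m)"
proof -
  have "\<forall>m. \<exists>X. finite X \<and> X \<subseteq> A \<and>
      (\<forall>Y. finite Y \<and> X \<subseteq> Y \<and> Y \<subseteq> A \<longrightarrow> coeff (sum f Y) m = coeff s m)"
    using assms(1) by (simp add: has_sum_def tendsto_mfps_iff eventually_finite_subsets_at_top)
  then obtain X where X: "\<And>m. finite (X m)" "\<And>m. X m \<subseteq> A"
    "\<And>m Y. finite Y \<Longrightarrow> X m \<subseteq> Y \<Longrightarrow> Y \<subseteq> A \<Longrightarrow> coeff (sum f Y) m = coeff s m"
    by metis
  let ?F = "\<Union>m\<in>M. X m"
  have F: "finite ?F" "?F \<subseteq> A" using assms(2) X(1,2) by auto
  have "coeff (f i) m = 0" if "m \<in> M" "i \<in> A - ?F" for i m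
  proof -
    \<comment> \<open>Adding \<open>i\<close> to a stabilised partial sum changes nothing, so
      \<open>f i\<close> itself has coefficient 0.\<close>
    have "coeff (sum f (insert i (X m))) m = coeff (sum f (X m)) m"
      using X(3)[of "insert i (X m)" m] X(3)[of "X m" m] X(1,2)[of m] that by auto
    then show ?thesis using that X(1)[of m] by auto
  qed
  moreover have "coeff s m = coeff (sum f ?F) m" if "m \<in> M" for m
    using X(3)[OF F(1) _ F(2), of m] that by (simp add: UN_upper)
  ultimately show ?thesis using F by (intro exI[of _ ?F]) auto
qed

lemma has_sum_mfps_iff:
  fixes f :: "'i \<Rightarrow> ('v, 'c::comm_ring_1) mfps"
  shows "(f has_sum s) A \<longleftrightarrow> (\<forall>m. \<exists>F. finite F \<and> F \<subseteq> A \<and> (\<forall>i\<in>A - F. coeff (f i) m = 0) \<and>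
      coeff s m = coeff (sum f F) m)" (is "_ \<longleftrightarrow> ?R")
proof
  assume "(f has_sum s) A"
  then show ?R using has_sum_mfpsD[of f A s "{_}"] by simp
next
  assume R: ?R
  show "(f has_sum s) A"
  proof (rule has_sum_mfpsI)
    fix m
    from R[rule_format, of m] obtain F
      where F: "finite F" "F \<subseteq> A" "\<forall>i\<in>A - F. coeff (f i) m = 0"
        "coeff s m = coeff (sum f F) m"
      by blast
    show "finite {i \<in> A. coeff (f i) m \<noteq> 0}"
      by (rule finite_subset[OF _ F(1)]) (use F(3) in auto)
    show "coeff s m = (\<Sum>i | i \<in> A \<and> coeff (f i) m \<noteq> 0. coeff (f i) m)"
      unfolding F(4) coeff_sum by (rule sum.mono_neutral_right) (use F(1-3) in auto)
  qed
qed

lemma summable_on_mfps_subset: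
  fixes f :: "'i \<Rightarrow> ('v, 'c::comm_ring_1) mfps"
  assumes "f summable_on A" "B \<subseteq> A"
  shows "f summable_on B"
proof (rule summable_on_mfpsI)
  fix m
  from assms(1) obtain s where "(f has_sum s) A" by (auto simp: summable_on_def)
  from this[unfolded has_sum_mfps_iff, rule_format, of m] obtain F
    where F: "finite F" "\<forall>i\<in>A - F. coeff (f i) m = 0"
    by blast
  show "finite {i \<in> B. coeff (f i) m \<noteq> 0}"
    by (rule finite_subset[OF _ F(1)]) (use F(2) assms(2) in auto)
qed

text \<open>At a fixed \<open>m\<close> both sums can be cut to finite sets valid at all factors of
  \<open>m\<close>; a pair outside \<open>F \<times> H\<close> has a component that vanishes at all
  these factors.\<close>

lemma has_sum_mfps_mult:
  fixes f :: "'i \<Rightarrow> ('v, 'c::comm_ring_1) mfps" and g :: "'j \<Rightarrow> ('v, 'c) mfps"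
  assumes "(f has_sum s) A" "(g has_sum t) B"
  shows "((\<lambda>(i, j). f i * g j) has_sum s * t) (A \<times> B)"
proof (unfold has_sum_mfps_iff, rule allI)
  fix m
  from has_sum_mfpsD[OF assms(1), of "fst ` splits m"] obtain F
    where F: "finite F" "F \<subseteq> A" "\<forall>a\<in>fst ` splits m. (\<forall>i\<in>A - F. coeff (f i) a = 0) \<and>
        coeff s a = coeff (sum f F) a"
    by auto
  from has_sum_mfpsD[OF assms(2), of "snd ` splits m"] obtain H
    where H: "finite H" "H \<subseteq> B" "\<forall>b\<in>snd ` splits m. (\<forall>j\<in>B - H. coeff (g j) b = 0) \<and>
        coeff t b = coeff (sum g H) b"
    by auto
  have fst: "a \<in> fst ` splits m" and snd: "b \<in> snd ` splits m" if "a + b = m" for a b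
    using that by (force simp: splits_def)+
  have "coeff (s * t) m = coeff (sum f F * sum g H) m"
    by (rule coeff_mult_cong) (use F(3) H(3) fst snd in blast)+
  also have "sum f F * sum g H = (\<Sum>(i, j)\<in>F \<times> H. f i * g j)"
    by (simp add: sum_product sum.cartesian_product)
  finally have "coeff (s * t) m = coeff (\<Sum>(i, j)\<in>F \<times> H. f i * g j) m" .
  moreover have "coeff (f i * g j) m = 0" if "(i, j) \<in> A \<times> B - F \<times> H" for i j
    by (rule coeff_mult_eq_0) (use that F(3) H(3) fst snd in blast)
  ultimately show "\<exists>K. finite K \<and> K \<subseteq> A \<times> B \<and>
      (\<forall>p\<in>A \<times> B - K. coeff (case p of (i, j) \<Rightarrow> f i * g j) m = 0) \<and>
      coeff (s * t) m = coeff (\<Sum>(i, j)\<in>K. f i * g j) m"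
    using F(1,2) H(1,2) by (intro exI[of _ "F \<times> H"]) auto
qed

lemma has_sum_mfps_cmult:
  fixes f :: "'i \<Rightarrow> ('v, 'c::comm_ring_1) mfps"
  assumes "(f has_sum s) A"
  shows "((\<lambda>i. c * f i) has_sum c * s) A"
proof -
  have "((\<lambda>(_, i). c * f i) has_sum c * s) ({()} \<times> A)"
    using has_sum_mfps_mult[OF has_sum_finite[of "{()}" "\<lambda>_. c"] assms] by simp
  moreover have "bij_betw (Pair ()) A ({()} \<times> A)"
    by (auto simp: bij_betw_def inj_on_def)
  ultimately show ?thesis
    using has_sum_reindex_bij_betw[of "Pair ()" A "{()} \<times> A" "\<lambda>(_, i). c * f i"] by simp
qed

text \<open>The initial segments exhaust \<open>A\<close>, and the coefficient at \<open>m\<close>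
  is final as soon as a segment contains the finite set carrying it.\<close>

lemma has_sum_initial_tendsto:
  fixes f :: "'i \<Rightarrow> ('v, 'c::comm_ring_1) mfps" and h :: "'i \<Rightarrow> nat"
  assumes "(f has_sum s) A" and "\<And>k. (f has_sum S k) {i \<in> A. h i \<le> k}"
  shows "S \<longlonglongrightarrow> s"
  unfolding tendsto_mfps_iff
proof
  fix m
  from assms(1)[unfolded has_sum_mfps_iff, rule_format, of m] obtain F
    where F: "finite F" "F \<subseteq> A" "\<forall>i\<in>A - F. coeff (f i) m = 0"
      "coeff s m = coeff (sum f F) m"
    by blast
  \<comment> \<open>The inserted 0 gives the maximum a value when \<open>F\<close> is empty.\<close>
  have "coeff (S k) m = coeff s m" if k: "k \<ge> Max (insert 0 (h ` F))" for k
  proof -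
    from assms(2)[of k, unfolded has_sum_mfps_iff, rule_format, of m] obtain H
      where H: "finite H" "H \<subseteq> {i \<in> A. h i \<le> k}"
        "\<forall>i\<in>{i \<in> A. h i \<le> k} - H. coeff (f i) m = 0"
        "coeff (S k) m = coeff (sum f H) m"
      by blast
    have "F \<subseteq> {i \<in> A. h i \<le> k}" using F(1,2) k by auto
    then have "coeff (sum f F) m = coeff (sum f (F \<union> H)) m" "coeff (sum f H) m = coeff (sum f (F \<union> H)) m"
      unfolding coeff_sum using F H by (auto intro!: sum.mono_neutral_left)
    then show ?thesis using F(4) H(4) by simp
  qed
  then show "\<forall>\<^sub>F k in sequentially. coeff (S k) m = coeff s m"
    unfolding eventually_sequentially by blast
qed

section \<open>Order of a power series\<close>

definition mdeg :: "('v \<Rightarrow>\<^sub>0 nat) \<Rightarrow> nat" where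
  "mdeg m = (\<Sum>v\<in>Poly_Mapping.keys m. Poly_Mapping.lookup m v)"

lemma mdeg_add: "mdeg (a + b) = mdeg a + mdeg b"
proof -
  have *: "mdeg m = (\<Sum>v\<in>K. Poly_Mapping.lookup m v)"
    if "finite K" "Poly_Mapping.keys m \<subseteq> K" for K and m :: "'a \<Rightarrow>\<^sub>0 nat"
    unfolding mdeg_def using that by (intro sum.mono_neutral_left) (auto simp: in_keys_iff)
  let ?K = "Poly_Mapping.keys a \<union> Poly_Mapping.keys b"
  show ?thesis
    by (simp add: *[of ?K] keys_add lookup_add sum.distrib)
qed

text \<open>Only a lower bound on the order is recorded, so the zero series needs no special value.
  All indeterminates have degree 1, those marking edges included.\<close>

definition ord_ge :: "nat \<Rightarrow> ('v, 'c::comm_ring_1) mfps \<Rightarrow> bool" where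
  "ord_ge n f \<longleftrightarrow> (\<forall>m. mdeg m < n \<longrightarrow> coeff f m = 0)"

lemma ord_ge_0 [simp]: "ord_ge 0 f"
  by (simp add: ord_ge_def)

lemma ord_ge_zero [simp]: "ord_ge n 0"
  by (simp add: ord_ge_def)

lemma ord_ge_add: "ord_ge n f \<Longrightarrow> ord_ge n g \<Longrightarrow> ord_ge n (f + g)"
  and ord_ge_diff: "ord_ge n f \<Longrightarrow> ord_ge n g \<Longrightarrow> ord_ge n (f - g)"
  and ord_ge_uminus: "ord_ge n f \<Longrightarrow> ord_ge n (- f)"
  and ord_ge_mono: "ord_ge n f \<Longrightarrow> k \<le> n \<Longrightarrow> ord_ge k f"
  by (auto simp: ord_ge_def)

lemma ord_ge_mult:
  assumes "ord_ge k f" "ord_ge n g"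
  shows "ord_ge (k + n) (f * g)"
  unfolding ord_ge_def
proof (intro allI impI)
  fix m :: "'a \<Rightarrow>\<^sub>0 nat" assume m: "mdeg m < k + n"
  show "coeff (f * g) m = 0"
  proof (rule coeff_mult_eq_0)
    fix a b assume "a + b = m"
    then have "mdeg a < k \<or> mdeg b < n" using m by (auto simp: mdeg_add)
    then show "coeff f a = 0 \<or> coeff g b = 0" using assms by (auto simp: ord_ge_def)
  qed
qed

lemma ord_ge_mult_right: "ord_ge n g \<Longrightarrow> ord_ge n (f * g)"
  using ord_ge_mult[of 0 f n g] by simp

lemma ord_ge_power: "ord_ge 1 f \<Longrightarrow> ord_ge n (f ^ n)"
  by (induction n) (auto intro: ord_ge_mult[of 1, simplified])

lemma ord_ge_Var: "ord_ge 1 (Var v)"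
  by (auto simp: ord_ge_def Var_def coeff_monom mdeg_def)

lemma ord_ge_tendsto:
  assumes "S \<longlonglongrightarrow> s" "\<And>k. ord_ge n (S k)"
  shows "ord_ge n s"
  unfolding ord_ge_def
proof (intro allI impI)
  fix m :: "'a \<Rightarrow>\<^sub>0 nat" assume m: "mdeg m < n"
  obtain k where "coeff (S k) m = coeff s m"
    using assms(1) unfolding tendsto_mfps_iff eventually_sequentially by blast
  then show "coeff s m = 0" using assms(2) m by (metis ord_ge_def)
qed

lemma ord_ge_has_sum:
  assumes "(f has_sum s) A" "\<And>i. i \<in> A \<Longrightarrow> ord_ge n (f i)"
  shows "ord_ge n s"
  unfolding ord_ge_def
proof (intro allI impI)
  fix m :: "'b \<Rightarrow>\<^sub>0 nat" assume m: "mdeg m < n"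
  from assms(1)[unfolded has_sum_mfps_iff, rule_format, of m] obtain F
    where F: "F \<subseteq> A" "coeff s m = coeff (sum f F) m"
    by blast
  then show "coeff s m = 0"
    using assms(2) m by (auto simp: coeff_sum ord_ge_def intro!: sum.neutral)
qed

text \<open>The inverse is the geometric series in \<open>- t\<close>, whose \<open>i\<close>-th
  term has order at least \<open>i\<close>.\<close>

lemma mfps_unit:
  fixes t :: "('v, 'c::comm_ring_1) mfps"
  assumes "ord_ge 1 t"
  shows "\<exists>v. (1 + t) * v = 1"
proof
  let ?geo = "\<lambda>n. \<Sum>i\<le>n. (- t) ^ i"
  \<comment> \<open>At \<open>m\<close> the powers above \<open>mdeg m\<close> contribute nothing,
    so stopping there gives the exact coefficient without a limit.\<close>
  let ?v = "Mfps (\<lambda>m. coeff (?geo (mdeg m)) m)"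
  have ord: "ord_ge i ((- t) ^ i)" for i
    by (intro ord_ge_power ord_ge_uminus assms)
  show "(1 + t) * ?v = 1"
  proof (rule mfps_eqI)
    fix m :: "'v \<Rightarrow>\<^sub>0 nat"
    have "coeff ?v b = coeff (?geo (mdeg m)) b" if "a + b = m" for a b
    proof -
      have "mdeg b \<le> mdeg m" using that by (auto simp: mdeg_add)
      moreover have "coeff ((- t) ^ i) b = 0" if "i > mdeg b" for i
        using ord[of i] that by (simp add: ord_ge_def)
      ultimately show ?thesis
        unfolding coeff_Mfps coeff_sum by (intro sum.mono_neutral_left) auto
    qed
    then have "coeff ((1 + t) * ?v) m = coeff ((1 - (- t)) * ?geo (mdeg m)) m"
      by (intro coeff_mult_cong) simp_all
    also have "(1 - (- t)) * ?geo (mdeg m) = 1 - (- t) ^ Suc (mdeg m)"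
      using sum_gp_basic[of "- t" "mdeg m"] by simp
    also have "coeff \<dots> m = coeff 1 m"
      using ord[of "Suc (mdeg m)"] by (simp add: ord_ge_def)
    finally show "coeff ((1 + t) * ?v) m = coeff 1 m" .
  qed
qed

lemma tendsto_mfps_diff:
  fixes S T :: "nat \<Rightarrow> ('v, 'c::comm_ring_1) mfps"
  assumes "S \<longlonglongrightarrow> s" "T \<longlonglongrightarrow> t"
  shows "(\<lambda>k. S k - T k) \<longlonglongrightarrow> s - t"
  unfolding tendsto_mfps_iff
proof
  fix m
  have "\<forall>\<^sub>F k in sequentially. coeff (S k) m = coeff s m"
    "\<forall>\<^sub>F k in sequentially. coeff (T k) m = coeff t m"
    using assms by (auto simp: tendsto_mfps_iff)
  then show "\<forall>\<^sub>F k in sequentially. coeff (S k - T k) m = coeff (s - t) m"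
    by eventually_elim simp
qed

text \<open>For large \<open>k\<close> the difference \<open>S k - s\<close> vanishes at all factors
  of \<open>m\<close>, which kills the product at \<open>m\<close> whatever \<open>h k\<close> is.
  Convergence thus passes through a quotient without studying the inverses.\<close>

lemma tendsto_mfps_mult_diff:
  fixes S :: "nat \<Rightarrow> ('v, 'c::comm_ring_1) mfps"
  assumes "S \<longlonglongrightarrow> s" and "\<And>k. W k - w = (S k - s) * h k"
  shows "W \<longlonglongrightarrow> w"
  unfolding tendsto_mfps_iff
proof
  fix m
  have "\<forall>\<^sub>F k in sequentially. \<forall>a\<in>fst ` splits m. coeff (S k) a = coeff s a"
    using assms(1) by (intro eventually_ball_finite) (auto simp: tendsto_mfps_iff)
  then show "\<forall>\<^sub>F k in sequentially. coeff (W k) m = coeff w m"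
  proof eventually_elim
    case (elim k)
    have "coeff ((S k - s) * h k) m = 0"
      by (rule coeff_mult_eq_0) (use elim in \<open>force simp: splits_def\<close>)
    then show ?case using arg_cong[OF assms(2)[of k], of "\<lambda>f. coeff f m"] by simp
  qed
qed

section \<open>Trees by root label\<close>

text \<open>Excluding \<open>Leaf\<close> makes the root label \<open>value T\<close>
  meaningful.\<close>

definition ptrees :: "nat tree set" where
  "ptrees = {T. T \<noteq> Leaf \<and> (\<forall>a\<in>set_tree T. 0 < a)}"

definition root_gf :: "(nat \<Rightarrow> bool) \<Rightarrow> (indet, 'c::comm_ring_1) mfps" where
  "root_gf P = (\<Sum>\<^sub>\<infinity>T\<in>{T \<in> ptrees. P (value T)}. tree_weight T)"

lemma has_sum_root_gf: "(tree_weight has_sum root_gf P) {T \<in> ptrees. P (value T)}"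
  unfolding root_gf_def
  by (intro has_sum_infsum summable_on_mfpsI finite_subset[OF _ finite_trees_coeff]) auto

lemma root_gf_disj:
  assumes "\<And>a. \<not> (P a \<and> Q a)"
  shows "root_gf (\<lambda>a. P a \<or> Q a) = root_gf P + root_gf Q"
proof (rule has_sum_unique[OF has_sum_root_gf])
  have "{T \<in> ptrees. P (value T) \<or> Q (value T)} =
      {T \<in> ptrees. P (value T)} \<union> {T \<in> ptrees. Q (value T)}" by auto
  then show "(tree_weight has_sum root_gf P + root_gf Q) {T \<in> ptrees. P (value T) \<or> Q (value T)}"
    using has_sum_Un_disjoint[OF has_sum_root_gf[of P] has_sum_root_gf[of Q]] assms by auto
qed

text \<open>At each monomial only a finite set \<open>F\<close> of trees counts, and the fibres of
  \<open>size\<close> on \<open>F\<close> give the terms of the sum over \<open>n\<close>.\<close>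

lemma root_gf_True: "(root_gf (\<lambda>_. True) :: (indet, 'c::comm_ring_1) mfps) = tree_gf"
proof -
  have "((\<lambda>n. \<Sum>\<^sub>\<infinity>T\<in>labeled_trees n. tree_weight T :: (indet, 'c) mfps) has_sum
      root_gf (\<lambda>_. True)) {1..}"
  proof (unfold has_sum_mfps_iff, rule allI)
    fix m
    let ?S = "\<lambda>n. \<Sum>\<^sub>\<infinity>T\<in>labeled_trees n. tree_weight T :: (indet, 'c) mfps"
    have "(tree_weight has_sum (root_gf (\<lambda>_. True) :: (indet, 'c) mfps)) ptrees"
      using has_sum_root_gf[of "\<lambda>_. True"] by simp
    from this[unfolded has_sum_mfps_iff, rule_format, of m] obtain F
      where F: "finite F" "F \<subseteq> ptrees"
        "\<forall>T\<in>ptrees - F. coeff (tree_weight T :: (indet, 'c) mfps) m = 0"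
        "coeff (root_gf (\<lambda>_. True) :: (indet, 'c) mfps) m = coeff (sum tree_weight F) m"
      by blast
    have tr: "labeled_trees n \<subseteq> ptrees" if "n \<ge> 1" for n
      using that by (auto simp: labeled_trees_def ptrees_def)
    have size: "size T \<ge> 1" if "T \<in> ptrees" for T
      using that by (cases T) (auto simp: ptrees_def)
    have lab: "{T \<in> F. size T = n} \<subseteq> labeled_trees n" for n
      using F(2) by (auto simp: labeled_trees_def ptrees_def)
    have coeff: "coeff (?S n) m = (\<Sum>T | T \<in> F \<and> size T = n. coeff (tree_weight T) m)"
      if "n \<ge> 1" for n
    proof -
      have "coeff (?S n) m = (\<Sum>T | T \<in> labeled_trees n \<and> coeff (tree_weight T :: (indet, 'c) mfps) m \<noteq> 0.
          coeff (tree_weight T) m)"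
        by (rule coeff_infsum) (auto intro: finite_subset[OF _ finite_trees_coeff])
      also have "\<dots> = (\<Sum>T | T \<in> F \<and> size T = n. coeff (tree_weight T) m)"
        by (rule sum.mono_neutral_left)
           (use F(1,3) tr[OF that] lab[of n] in \<open>auto simp: labeled_trees_def\<close>)
      finally show ?thesis .
    qed
    show "\<exists>N. finite N \<and> N \<subseteq> {1..} \<and> (\<forall>n\<in>{1..} - N. coeff (?S n) m = 0) \<and>
        coeff (root_gf (\<lambda>_. True)) m = coeff (sum ?S N) m"
    proof (intro exI[of _ "size ` F"] conjI ballI)
      show "finite (size ` F)" using F(1) by simp
      show sub: "size ` F \<subseteq> {1..}" using F(2) size by auto
      show "coeff (?S n) m = 0" if "n \<in> {1..} - size ` F" for n
        using that by (subst coeff) (auto intro!: sum.neutral)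
      have "coeff (sum ?S (size ` F)) m =
          (\<Sum>n\<in>size ` F. \<Sum>T | T \<in> F \<and> size T = n. coeff (tree_weight T) m)"
        unfolding coeff_sum using sub by (intro sum.cong coeff) auto
      also have "\<dots> = (\<Sum>T\<in>F. coeff (tree_weight T) m)"
        by (rule sum.image_gen[symmetric]) (rule F(1))
      finally show "coeff (root_gf (\<lambda>_. True)) m = coeff (sum ?S (size ` F)) m"
        by (simp add: F(4) coeff_sum)
    qed
  qed
  then show ?thesis
    unfolding tree_gf_def by (rule infsumI[symmetric])
qed

text \<open>This is the contribution of one child position: 1 if the child is absent, otherwise an
  edge weight chosen by the child's label. Left and right children are both instances.\<close>

lemma has_sum_child:
  fixes c d :: "(indet, 'c::comm_ring_1) mfps"
  shows "((\<lambda>T. case T of Leaf \<Rightarrow> 1 | Node _ b _ \<Rightarrow> (if P b then c else d) * tree_weight T) has_sum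
    1 + c * root_gf P + d * (tree_gf - root_gf P)) (insert Leaf ptrees)"
    (is "(?f has_sum _) _")
proof -
  have split: "tree_gf - root_gf P = root_gf (\<lambda>b. \<not> P b)"
    using root_gf_disj[of P "\<lambda>b. \<not> P b"] by (simp add: root_gf_True algebra_simps)
  have 1: "(?f has_sum 1) {Leaf}"
    by (rule has_sum_finiteI) auto
  have "((\<lambda>T. c * tree_weight T) has_sum c * root_gf P) {T \<in> ptrees. P (value T)}"
    by (rule has_sum_mfps_cmult[OF has_sum_root_gf])
  then have 2: "(?f has_sum c * root_gf P) {T \<in> ptrees. P (value T)}"
    by (rule has_sum_cong[THEN iffD1, rotated]) (auto simp: ptrees_def split: tree.splits)
  have "((\<lambda>T. d * tree_weight T) has_sum d * root_gf (\<lambda>b. \<not> P b)) {T \<in> ptrees. \<not> P (value T)}"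
    by (rule has_sum_mfps_cmult[OF has_sum_root_gf])
  then have 3: "(?f has_sum d * root_gf (\<lambda>b. \<not> P b)) {T \<in> ptrees. \<not> P (value T)}"
    by (rule has_sum_cong[THEN iffD1, rotated]) (auto simp: ptrees_def split: tree.splits)
  have "{Leaf} \<union> {T \<in> ptrees. P (value T)} \<union> {T \<in> ptrees. \<not> P (value T)} = insert Leaf ptrees"
    by auto
  then show ?thesis
    using has_sum_Un_disjoint[OF has_sum_Un_disjoint[OF 1 2] 3] unfolding split
    by (auto simp: ptrees_def)
qed

section \<open>Splitting a tree at its root\<close>

lemma x_word_append: "x_word (u @ w) = x_word u * x_word w"
  by (simp add: x_word_def)

text \<open>The right edge is tested by \<open>b < a\<close>, with \<open>rho\<close> first, so that
  on both sides the tested labels form an initial segment.\<close>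

lemma tree_weight_Node:
  "tree_weight (Node l a r) = x_var a *
    ((case l of Leaf \<Rightarrow> 1 | Node _ b _ \<Rightarrow> (if b \<le> a then lam_bar else lam) * tree_weight l) *
     (case r of Leaf \<Rightarrow> 1 | Node _ b _ \<Rightarrow> (if b < a then rho else rho_bar) * tree_weight r))"
  unfolding tree_weight_def x_tree_def
  by (cases l; cases r) (auto simp: x_word_append x_word_def power_add algebra_simps)

lemma root_gf_eq:
  assumes "a > 0"
  shows "(root_gf (\<lambda>b. b = a) :: (indet, 'c::comm_ring_1) mfps) = x_var a *
    ((1 + lam_bar * root_gf (\<lambda>b. b \<le> a) + lam * (tree_gf - root_gf (\<lambda>b. b \<le> a))) *
     (1 + rho * root_gf (\<lambda>b. b < a) + rho_bar * (tree_gf - root_gf (\<lambda>b. b < a))))"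
    (is "_ = ?r")
proof (rule has_sum_unique[OF has_sum_root_gf])
  have "((\<lambda>(l, r). tree_weight (Node l a r) :: (indet, 'c) mfps) has_sum ?r)
      (insert Leaf ptrees \<times> insert Leaf ptrees)"
    using has_sum_mfps_cmult[OF has_sum_mfps_mult[OF has_sum_child[of "\<lambda>b. b \<le> a" lam_bar lam]
          has_sum_child[of "\<lambda>b. b < a" rho rho_bar]], of "x_var a"]
    by (simp add: tree_weight_Node case_prod_unfold)
  moreover have "inj_on (\<lambda>(l, r). Node l a r) (insert Leaf ptrees \<times> insert Leaf ptrees)"
    by (auto simp: inj_on_def)
  moreover have "(\<lambda>(l, r). Node l a r) ` (insert Leaf ptrees \<times> insert Leaf ptrees) =
      {T \<in> ptrees. value T = a}"
  proof (intro equalityI subsetI)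
    fix T assume "T \<in> {T \<in> ptrees. value T = a}"
    then obtain l r where "T = Node l a r" "l \<in> insert Leaf ptrees" "r \<in> insert Leaf ptrees"
      by (cases T) (auto simp: ptrees_def)
    then show "T \<in> (\<lambda>(l, r). Node l a r) ` (insert Leaf ptrees \<times> insert Leaf ptrees)"
      by (metis (mono_tags, lifting) SigmaI case_prod_conv image_eqI)
  qed (use assms in \<open>auto simp: ptrees_def\<close>)
  ultimately show "(tree_weight has_sum ?r) {T \<in> ptrees. value T = a}"
    using has_sum_reindex[of "\<lambda>(l, r). Node l a r" "insert Leaf ptrees \<times> insert Leaf ptrees"
        tree_weight ?r]
    by (simp add: o_def case_prod_unfold)
qed

text \<open>Equal labels form an ascent on either side, so the left test is weak and the right one
  strict; hence one factor involves \<open>S (Suc k)\<close> and the other only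
  \<open>S k\<close>.\<close>

lemma root_gf_step:
  fixes S :: "nat \<Rightarrow> (indet, 'c::comm_ring_1) mfps"
  defines "S \<equiv> \<lambda>k. root_gf (\<lambda>b. b \<le> k)"
  shows "S (Suc k) - S k = x_var (Suc k) *
    ((1 + lam_bar * S (Suc k) + lam * (tree_gf - S (Suc k))) *
     (1 + rho * S k + rho_bar * (tree_gf - S k)))"
proof -
  have "(\<lambda>b. b \<le> Suc k) = (\<lambda>b. b \<le> k \<or> b = Suc k)" by auto
  then have "S (Suc k) - S k = root_gf (\<lambda>b. b = Suc k)"
    by (simp add: S_def root_gf_disj)
  then show ?thesis
    by (simp add: S_def root_gf_eq less_Suc_eq_le)
qed

lemma root_gf_le_0: "root_gf (\<lambda>b. b \<le> 0) = 0"
proof (rule has_sum_unique[OF has_sum_root_gf])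
  have "{T \<in> ptrees. value T \<le> 0} = {}"
    by (auto simp: ptrees_def neq_Leaf_iff)
  then show "(tree_weight has_sum 0) {T \<in> ptrees. value T \<le> 0}" by (metis has_sum_empty)
qed

lemma root_gf_tendsto: "(\<lambda>k. root_gf (\<lambda>b. b \<le> k)) \<longlonglongrightarrow> tree_gf"
  unfolding root_gf_True[symmetric]
  by (rule has_sum_initial_tendsto[OF has_sum_root_gf, where h = "value"])
     (use has_sum_root_gf in auto)

lemma ord_ge_root_gf: "ord_ge 1 (root_gf P)"
proof (rule ord_ge_has_sum[OF has_sum_root_gf])
  fix T assume "T \<in> {T \<in> ptrees. P (value T)}"
  then obtain l a r where "T = Node l a r" by (auto simp: ptrees_def neq_Leaf_iff)
  then show "ord_ge 1 (tree_weight T)"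
    using ord_ge_mult[OF ord_ge_Var ord_ge_0] by (simp add: tree_weight_Node)
qed

section \<open>Words by runs and by first letter\<close>

text \<open>The lengths of the maximal weakly increasing runs; they form the composition that
  encodes the descent set.\<close>

fun runs :: "nat list \<Rightarrow> nat list" where
  "runs [] = []"
| "runs [a] = [1]"
| "runs (a # b # w) =
     (if a \<le> b then Suc (hd (runs (b # w))) # tl (runs (b # w)) else 1 # runs (b # w))"

lemma runs_eq_Nil_iff [simp]: "runs w = [] \<longleftrightarrow> w = []"
  by (induction w rule: runs.induct) auto

lemma runs_compositions: "runs w \<in> compositions (length w)"
proof (induction w rule: runs.induct)
  case (3 a b w)
  then show ?case
    by (cases "runs (b # w)") (auto simp: compositions_def dest: runs_eq_Nil_iff[THEN iffD1])
qed (auto simp: compositions_def)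

lemma comp_set_Nil [simp]: "comp_set [] = {}"
  by (simp add: comp_set_def)

text \<open>\<open>comp_set\<close> omits the total sum, so a single part yields nothing, while
  before a nonempty tail \<open>a\<close> is itself a proper partial sum and shifts all
  others.\<close>

lemma comp_set_Cons:
  "comp_set (a # \<alpha>) = (if \<alpha> = [] then {} else insert a ((+) a ` comp_set \<alpha>))"
proof -
  have "comp_set (a # \<alpha>) = (\<lambda>i. sum_list (take i (a # \<alpha>))) ` {1..<Suc (length \<alpha>)}"
    by (auto simp: comp_set_def)
  also have "{1..<Suc (length \<alpha>)} = Suc ` {0..<length \<alpha>}"
    by (simp add: image_Suc_atLeastLessThan)
  also have "(\<lambda>i. sum_list (take i (a # \<alpha>))) ` \<dots> = (\<lambda>i. a + sum_list (take i \<alpha>)) ` {0..<length \<alpha>}"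
    by (simp only: image_image take_Suc_Cons sum_list.Cons)
  also have "\<dots> = (if \<alpha> = [] then {} else insert a ((+) a ` comp_set \<alpha>))"
  proof (cases "\<alpha> = []")
    case False
    then have "{0..<length \<alpha>} = insert 0 {1..<length \<alpha>}" by auto
    moreover have "comp_set \<alpha> = (\<lambda>i. sum_list (take i \<alpha>)) ` {1..<length \<alpha>}"
      by (auto simp: comp_set_def)
    ultimately show ?thesis using False by (simp add: image_image)
  qed simp
  finally show ?thesis .
qed

lemma comp_set_pos: "\<forall>a\<in>set \<alpha>. 0 < a \<Longrightarrow> i \<in> comp_set \<alpha> \<Longrightarrow> 0 < i"
  by (cases \<alpha>) (auto simp: comp_set_Cons split: if_splits)

text \<open>The first part is the least element of the set, or \<open>n\<close> if the set is empty;
  removing it and shifting back leaves the set of the remaining parts.\<close>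

lemma comp_set_inject:
  assumes "\<alpha> \<in> compositions n" "\<beta> \<in> compositions n" "comp_set \<alpha> = comp_set \<beta>"
  shows "\<alpha> = \<beta>"
  using assms
proof (induction \<alpha> arbitrary: \<beta> n)
  case Nil
  then show ?case by (cases \<beta>) (auto simp: compositions_def)
next
  case (Cons a \<alpha>)
  then obtain b \<beta>' where \<beta>: "\<beta> = b # \<beta>'"
    by (cases \<beta>) (auto simp: compositions_def)
  show ?case
  proof (cases "\<alpha> = []")
    case True
    then show ?thesis using Cons.prems \<beta>
      by (auto simp: compositions_def comp_set_Cons split: if_splits)
  next
    case False
    then have ne: "\<beta>' \<noteq> []" using Cons.prems(3) \<beta> by (auto simp: comp_set_Cons)
    have eq: "insert a ((+) a ` comp_set \<alpha>) = insert b ((+) b ` comp_set \<beta>')"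
      using Cons.prems(3) False ne \<beta> by (simp add: comp_set_Cons)
    have pos: "0 < i" if "i \<in> comp_set \<alpha> \<or> i \<in> comp_set \<beta>'" for i
      using that comp_set_pos[of \<alpha> i] comp_set_pos[of \<beta>' i] Cons.prems(1,2) \<beta>
      by (auto simp: compositions_def)
    have "a \<in> insert b ((+) b ` comp_set \<beta>')" "b \<in> insert a ((+) a ` comp_set \<alpha>)"
      using eq by blast+
    then have ab: "a = b" by auto
    \<comment> \<open>The sets contain no 0, so the inserted element is new and can be cancelled
      from both sides.\<close>
    have notin: "a \<notin> (+) a ` comp_set \<alpha>" "a \<notin> (+) a ` comp_set \<beta>'"
      using pos[of 0] by auto
    have "(+) a ` comp_set \<alpha> = (+) a ` comp_set \<beta>'"
      using eq notin unfolding ab by (metis insert_ident)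
    then have "comp_set \<alpha> = comp_set \<beta>'"
      by (simp add: inj_image_eq_iff)
    moreover have "\<alpha> \<in> compositions (n - a)" "\<beta>' \<in> compositions (n - a)"
      using Cons.prems(1,2) \<beta> ab by (auto simp: compositions_def)
    ultimately show ?thesis using Cons.IH \<beta> ab by blast
  qed
qed

lemma word_des_Cons:
  "word_des (a # b # w) = (if a > b then {1} else {}) \<union> Suc ` word_des (b # w)"
proof (intro set_eqI)
  fix i
  show "i \<in> word_des (a # b # w) \<longleftrightarrow> i \<in> (if a > b then {1} else {}) \<union> Suc ` word_des (b # w)"
  proof (cases i)
    case (Suc j)
    then show ?thesis by (cases j) (auto simp: word_des_def image_iff)
  qed (auto simp: word_des_def)
qed

text \<open>Descents occur exactly between runs: a new first letter shifts all positions by one and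
  adds position 1 just when it forms a run of its own.\<close>

lemma comp_set_runs: "comp_set (runs w) = word_des w"
proof (induction w rule: runs.induct)
  case (3 a b w)
  obtain c \<alpha> where c: "runs (b # w) = c # \<alpha>" by (metis list.exhaust list.distinct(1) runs_eq_Nil_iff)
  show ?case
  proof (cases "a \<le> b")
    case True
    then have "comp_set (runs (a # b # w)) = Suc ` comp_set (runs (b # w))"
      by (simp add: c comp_set_Cons image_image)
    with True 3 show ?thesis by (simp add: word_des_Cons)
  next
    case False
    then have "comp_set (runs (a # b # w)) = insert 1 (Suc ` comp_set (runs (b # w)))"
      by (simp add: comp_set_Cons)
    with False 3 show ?thesis by (simp add: word_des_Cons)
  qed
qed (auto simp: comp_set_def word_des_def)

text \<open>Since a descent set determines its composition, the ribbon words are the fibres of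
  \<open>runs\<close> and partition the words of length \<open>n\<close>.\<close>

lemma ribbon_words_eq:
  assumes "\<alpha> \<in> compositions n"
  shows "ribbon_words \<alpha> = {w. length w = n \<and> (\<forall>a\<in>set w. 0 < a) \<and> runs w = \<alpha>}"
proof -
  have "word_des w = comp_set \<alpha> \<longleftrightarrow> runs w = \<alpha>" if "length w = n" for w
    using comp_set_inject[OF runs_compositions, of \<alpha> w] assms that comp_set_runs by auto
  then show ?thesis using assms by (auto simp: ribbon_words_def compositions_def)
qed

section \<open>Weighted words of fixed length\<close>

definition pwords :: "nat \<Rightarrow> nat list set" where
  "pwords n = {w. length w = n \<and> (\<forall>a\<in>set w. 0 < a)}"

context
  fixes A D :: "(indet, 'c::comm_ring_1) mfps"
begin

fun word_weight :: "nat list \<Rightarrow> (indet, 'c) mfps" where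
  "word_weight [] = 1"
| "word_weight [a] = x_var a"
| "word_weight (a # b # w) = (if a \<le> b then A else D) * x_var a * word_weight (b # w)"

text \<open>A run of length \<open>c\<close> contains \<open>c - 1\<close> weak ascents, and one
  descent separates consecutive runs.\<close>

lemma word_weight_runs:
  "word_weight w = A ^ (length w - length (runs w)) * D ^ (length (runs w) - 1) * x_word w"
proof (induction w rule: runs.induct)
  case (3 a b w)
  \<comment> \<open>This makes the natural subtraction exact; \<open>k\<close> and \<open>j\<close>
    count the ascents and descents of the tail.\<close>
  have "length (runs (b # w)) \<le> length (b # w)" for b w
    by (induction "b # w" arbitrary: b w rule: runs.induct) auto
  from this[of b w] obtain k where k: "length (b # w) = length (runs (b # w)) + k"
    using le_Suc_ex by blast
  obtain j where j: "length (runs (b # w)) = Suc j"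
    by (metis list.distinct(1) list.exhaust length_Cons runs_eq_Nil_iff)
  have w: "word_weight (b # w) = A ^ k * D ^ j * x_word (b # w)"
    using 3 k j by (cases "a \<le> b") simp_all
  have x: "x_word (a # b # w) = x_var a * x_word (b # w)" by (simp add: x_word_def)
  show ?case
  proof (cases "a \<le> b")
    case True
    then have "length (a # b # w) - length (runs (a # b # w)) = Suc k"
        "length (runs (a # b # w)) - 1 = j"
      using k j by simp_all
    then show ?thesis unfolding x using True by (simp only:) (simp add: w mult_ac)
  next
    case False
    then have "length (a # b # w) - length (runs (a # b # w)) = k"
        "length (runs (a # b # w)) - 1 = Suc j"
      using k j by simp_all
    then show ?thesis unfolding x using False by (simp only:) (simp add: w mult_ac)
  qed
qed (auto simp: x_word_def)

text \<open>The powers of \<open>A\<close> and \<open>D\<close> are constant on each of the finitely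
  many classes of \<open>runs\<close>. The result also supplies the summability behind
  \<open>word_gf\<close>, with \<open>A\<close> and \<open>D\<close> arbitrary series.\<close>

lemma has_sum_word_weight_pwords:
  "(word_weight has_sum
    (\<Sum>\<alpha>\<in>compositions n. A ^ (n - length \<alpha>) * D ^ (length \<alpha> - 1) * ribbon \<alpha>)) (pwords n)"
proof -
  have "(word_weight has_sum
    (\<Sum>\<alpha>\<in>compositions n. A ^ (n - length \<alpha>) * D ^ (length \<alpha> - 1) * ribbon \<alpha>))
    (\<Union>\<alpha>\<in>compositions n. ribbon_words \<alpha>)"
  proof (rule sum_has_sum[OF finite_compositions])
    fix \<alpha> assume \<alpha>: "\<alpha> \<in> compositions n"
    have "((\<lambda>w. A ^ (n - length \<alpha>) * D ^ (length \<alpha> - 1) * x_word w) has_sum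
        A ^ (n - length \<alpha>) * D ^ (length \<alpha> - 1) * ribbon \<alpha>) (ribbon_words \<alpha>)"
      unfolding ribbon_def by (intro has_sum_mfps_cmult has_sum_infsum ribbon_summable)
    then show "(word_weight has_sum A ^ (n - length \<alpha>) * D ^ (length \<alpha> - 1) * ribbon \<alpha>) (ribbon_words \<alpha>)"
      by (rule has_sum_cong[THEN iffD1, rotated]) (simp add: ribbon_words_eq[OF \<alpha>] word_weight_runs)
  next
    fix \<alpha> \<beta> assume "\<alpha> \<in> compositions n" "\<beta> \<in> compositions n" "\<alpha> \<noteq> \<beta>"
    then show "ribbon_words \<alpha> \<inter> ribbon_words \<beta> = {}" by (auto simp: ribbon_words_eq)
  qed
  moreover have "(\<Union>\<alpha>\<in>compositions n. ribbon_words \<alpha>) = pwords n"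
    using runs_compositions by (auto simp: ribbon_words_eq pwords_def)
  ultimately show ?thesis by simp
qed

text \<open>Only meaningful for \<open>n > 0\<close>, since \<^term>\<open>hd []\<close> is unspecified.\<close>

definition word_gf :: "nat \<Rightarrow> (nat \<Rightarrow> bool) \<Rightarrow> (indet, 'c) mfps" where
  "word_gf n P = (\<Sum>\<^sub>\<infinity>w\<in>{w \<in> pwords n. P (hd w)}. word_weight w)"

lemma has_sum_word_gf: "(word_weight has_sum word_gf n P) {w \<in> pwords n. P (hd w)}"
  unfolding word_gf_def
  by (rule has_sum_infsum, rule summable_on_mfps_subset[of word_weight "pwords n"])
     (use has_sum_word_weight_pwords[of n] in \<open>auto simp: summable_on_def\<close>)

lemma word_gf_True:
  "word_gf n (\<lambda>_. True) =
    (\<Sum>\<alpha>\<in>compositions n. A ^ (n - length \<alpha>) * D ^ (length \<alpha> - 1) * ribbon \<alpha>)"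
  using has_sum_unique[OF has_sum_word_gf[of n "\<lambda>_. True"]] has_sum_word_weight_pwords[of n] by simp

lemma word_gf_disj:
  assumes "\<And>a. \<not> (P a \<and> Q a)"
  shows "word_gf n (\<lambda>a. P a \<or> Q a) = word_gf n P + word_gf n Q"
proof (rule has_sum_unique[OF has_sum_word_gf])
  have "{w \<in> pwords n. P (hd w) \<or> Q (hd w)} =
      {w \<in> pwords n. P (hd w)} \<union> {w \<in> pwords n. Q (hd w)}" by auto
  then show "(word_weight has_sum word_gf n P + word_gf n Q) {w \<in> pwords n. P (hd w) \<or> Q (hd w)}"
    using has_sum_Un_disjoint[OF has_sum_word_gf[of n P] has_sum_word_gf[of n Q]] assms by auto
qed

lemma word_gf_Suc_0_eq:
  assumes "a > 0"
  shows "word_gf (Suc 0) (\<lambda>b. b = a) = x_var a"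
proof (rule has_sum_unique[OF has_sum_word_gf])
  have "{w \<in> pwords (Suc 0). hd w = a} = {[a]}"
    using assms by (auto simp: pwords_def length_Suc_conv)
  then show "(word_weight has_sum x_var a) {w \<in> pwords (Suc 0). hd w = a}"
    by (simp add: has_sum_finite_iff)
qed

text \<open>Deleting the first letter leaves a nonempty word whose own first letter decides between
  \<open>A\<close> and \<open>D\<close>.\<close>

lemma word_gf_Suc_Suc_eq:
  assumes "a > 0"
  shows "word_gf (Suc (Suc n)) (\<lambda>b. b = a) =
    x_var a * (A * word_gf (Suc n) (\<lambda>b. \<not> b < a) + D * word_gf (Suc n) (\<lambda>b. b < a))"
proof (rule has_sum_unique[OF has_sum_word_gf])
  have w: "word_weight (a # w) = (if hd w < a then D else A) * x_var a * word_weight w"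
    if "w \<in> pwords (Suc n)" for w
    using that by (cases w) (auto simp: pwords_def)
  have 1: "((\<lambda>w. word_weight (a # w)) has_sum A * x_var a * word_gf (Suc n) (\<lambda>b. \<not> b < a))
      {w \<in> pwords (Suc n). \<not> hd w < a}"
    using has_sum_mfps_cmult[OF has_sum_word_gf[of "Suc n" "\<lambda>b. \<not> b < a"], of "A * x_var a"]
    by (rule has_sum_cong[THEN iffD1, rotated]) (simp add: w)
  have 2: "((\<lambda>w. word_weight (a # w)) has_sum D * x_var a * word_gf (Suc n) (\<lambda>b. b < a))
      {w \<in> pwords (Suc n). hd w < a}"
    using has_sum_mfps_cmult[OF has_sum_word_gf[of "Suc n" "\<lambda>b. b < a"], of "D * x_var a"]
    by (rule has_sum_cong[THEN iffD1, rotated]) (simp add: w)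
  have "{w \<in> pwords (Suc n). \<not> hd w < a} \<union> {w \<in> pwords (Suc n). hd w < a} = pwords (Suc n)"
    by auto
  then have "((\<lambda>w. word_weight (a # w)) has_sum A * x_var a * word_gf (Suc n) (\<lambda>b. \<not> b < a) +
      D * x_var a * word_gf (Suc n) (\<lambda>b. b < a)) (pwords (Suc n))"
    using has_sum_Un_disjoint[OF 1 2] by auto
  moreover have "bij_betw ((#) a) (pwords (Suc n)) {w \<in> pwords (Suc (Suc n)). hd w = a}"
    using assms by (auto simp: bij_betw_def pwords_def image_iff length_Suc_conv)
  ultimately have "(word_weight has_sum A * x_var a * word_gf (Suc n) (\<lambda>b. \<not> b < a) +
      D * x_var a * word_gf (Suc n) (\<lambda>b. b < a)) {w \<in> pwords (Suc (Suc n)). hd w = a}"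
    by (simp add: has_sum_reindex_bij_betw)
  then show "(word_weight has_sum x_var a *
      (A * word_gf (Suc n) (\<lambda>b. \<not> b < a) + D * word_gf (Suc n) (\<lambda>b. b < a)))
      {w \<in> pwords (Suc (Suc n)). hd w = a}"
    by (simp add: algebra_simps)
qed

section \<open>Recurrence in the bound on the first letter\<close>

lemma word_gf_le_Suc:
  "word_gf n (\<lambda>b. b \<le> Suc k) - word_gf n (\<lambda>b. b \<le> k) = word_gf n (\<lambda>b. b = Suc k)"
proof -
  have "(\<lambda>b. b \<le> Suc k) = (\<lambda>b. b \<le> k \<or> b = Suc k)" by auto
  then show ?thesis using word_gf_disj[of "\<lambda>b. b \<le> k" "\<lambda>b. b = Suc k" n] by simp
qed

lemma word_gf_step_0:
  "word_gf (Suc 0) (\<lambda>b. b \<le> Suc k) - word_gf (Suc 0) (\<lambda>b. b \<le> k) = x_var (Suc k)"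
  by (simp add: word_gf_le_Suc word_gf_Suc_0_eq)

lemma word_gf_step_Suc:
  "word_gf (Suc (Suc n)) (\<lambda>b. b \<le> Suc k) - word_gf (Suc (Suc n)) (\<lambda>b. b \<le> k) =
    x_var (Suc k) * (A * word_gf (Suc n) (\<lambda>_. True) - (A - D) * word_gf (Suc n) (\<lambda>b. b \<le> k))"
  using word_gf_disj[of "\<lambda>b. b \<le> k" "\<lambda>b. \<not> b \<le> k" "Suc n"]
  by (simp add: word_gf_le_Suc word_gf_Suc_Suc_eq less_Suc_eq_le algebra_simps)

lemma word_gf_le_0: "word_gf (Suc n) (\<lambda>b. b \<le> 0) = 0"
proof (rule has_sum_unique[OF has_sum_word_gf])
  have "{w \<in> pwords (Suc n). hd w \<le> 0} = {}"
    by (auto simp: pwords_def length_Suc_conv)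
  then show "(word_weight has_sum 0) {w \<in> pwords (Suc n). hd w \<le> 0}" by (metis has_sum_empty)
qed

lemma word_gf_tendsto: "(\<lambda>k. word_gf n (\<lambda>b. b \<le> k)) \<longlonglongrightarrow> word_gf n (\<lambda>_. True)"
proof (rule has_sum_initial_tendsto)
  show "(word_weight has_sum word_gf n (\<lambda>_. True)) (pwords n)"
    using has_sum_word_gf[of n "\<lambda>_. True"] by simp
  show "(word_weight has_sum word_gf n (\<lambda>b. b \<le> k)) {w \<in> pwords n. hd w \<le> k}" for k
    by (rule has_sum_word_gf)
qed

text \<open>
  Unrolling the recurrence \<open>n\<close> times splits off the words of length at most \<open>n\<close>; every step gains
  a factor \<open>x\<^sub>k\<close>, so the remainders \<open>E n k\<close> and \<open>E' n\<close> have order greater than \<open>n\<close>.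
\<close>

lemma has_sum_word_gf_of_recurrence:
  assumes W0: "W 0 = 0" and ord: "\<And>k. ord_ge 1 (W k)" and lim: "W \<longlonglongrightarrow> g"
    and step: "\<And>k. W (Suc k) - W k = x_var (Suc k) * (1 + A * g - (A - D) * W k)"
  shows "((\<lambda>n. word_gf n (\<lambda>_. True)) has_sum g) {1..}"
proof -
  define E where "E n k = W k - (\<Sum>i<n. word_gf (Suc i) (\<lambda>b. b \<le> k))" for n k
  define E' where "E' n = g - (\<Sum>i<n. word_gf (Suc i) (\<lambda>_. True))" for n
  have E_lim: "E n \<longlonglongrightarrow> E' n" for n
    unfolding E_def E'_def by (intro tendsto_mfps_diff lim tendsto_sum word_gf_tendsto)
  \<comment> \<open>One-letter words absorb the constant 1 of \<open>step\<close>; subtracting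
    longer words then only replaces the remainders on the right by the next ones.\<close>
  have E_step: "E (Suc n) (Suc k) - E (Suc n) k = x_var (Suc k) * (A * E' n - (A - D) * E n k)" for n k
  proof (induction n)
    case 0
    have "E (Suc 0) (Suc k) - E (Suc 0) k = (W (Suc k) - W k) -
        (word_gf (Suc 0) (\<lambda>b. b \<le> Suc k) - word_gf (Suc 0) (\<lambda>b. b \<le> k))"
      by (simp add: E_def)
    then show ?case
      unfolding step word_gf_step_0 by (simp add: E_def E'_def algebra_simps)
  next
    case (Suc n)
    have "E (Suc (Suc n)) (Suc k) - E (Suc (Suc n)) k = (E (Suc n) (Suc k) - E (Suc n) k) -
        (word_gf (Suc (Suc n)) (\<lambda>b. b \<le> Suc k) - word_gf (Suc (Suc n)) (\<lambda>b. b \<le> k))"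
      by (simp add: E_def)
    then show ?case
      unfolding Suc.IH word_gf_step_Suc by (simp add: E_def E'_def algebra_simps)
  qed
  have E_ord: "(\<forall>k. ord_ge (Suc n) (E n k)) \<and> ord_ge (Suc n) (E' n)" for n
  proof (induction n)
    case 0
    have "ord_ge 1 g" by (rule ord_ge_tendsto[OF lim ord])
    then show ?case using ord by (simp add: E_def E'_def)
  next
    case (Suc n)
    \<comment> \<open>The remainder starts at 0 for \<open>k = 0\<close>, and each increment has a
      factor \<open>x_var (Suc k)\<close> that raises the order by one; the limit in
      \<open>k\<close> carries the bound over to \<open>E'\<close>.\<close>
    have "ord_ge (Suc (Suc n)) (E (Suc n) k)" for k
    proof (induction k)
      case 0
      then show ?case by (simp add: E_def W0 word_gf_le_0[simplified])
    next
      case (Suc k)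
      have "ord_ge (1 + Suc n) (x_var (Suc k) * (A * E' n - (A - D) * E n k))"
        using \<open>(\<forall>k. ord_ge (Suc n) (E n k)) \<and> ord_ge (Suc n) (E' n)\<close>
        by (intro ord_ge_mult ord_ge_Var ord_ge_diff ord_ge_mult_right) auto
      then have "ord_ge (Suc (Suc n)) (E (Suc n) k + (E (Suc n) (Suc k) - E (Suc n) k))"
        unfolding E_step by (intro ord_ge_add Suc) simp
      then show ?case by simp
    qed
    then show ?case using ord_ge_tendsto[OF E_lim] by blast
  qed
  show ?thesis
  proof (unfold has_sum_mfps_iff, rule allI)
    fix m :: "indet \<Rightarrow>\<^sub>0 nat"
    \<comment> \<open>\<open>E' (mdeg m)\<close> has order above \<open>mdeg m\<close>, so words of
      length at most \<open>mdeg m\<close> account for the whole coefficient.\<close>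
    let ?F = "{Suc 0..mdeg m}"
    have "coeff (word_gf n (\<lambda>_. True)) m = 0" if n: "n \<in> {1..} - ?F" for n
    proof -
      obtain j where j: "n = Suc j" using n by (cases n) auto
      \<comment> \<open>As a difference of consecutive remainders it inherits order
        \<open>n\<close>, without inspecting words.\<close>
      have "word_gf n (\<lambda>_. True) = E' j - E' (Suc j)" by (simp add: E'_def j)
      moreover have "ord_ge n (E' j - E' (Suc j))"
        using E_ord[of j] E_ord[of "Suc j"] ord_ge_mono[of "Suc (Suc j)" "E' (Suc j)" "Suc j"]
        by (intro ord_ge_diff) (auto simp: j)
      ultimately show ?thesis using n by (auto simp: ord_ge_def)
    qed
    moreover have "coeff g m = coeff (\<Sum>n\<in>?F. word_gf n (\<lambda>_. True)) m"
    proof -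
      have "coeff (E' (mdeg m)) m = 0" using E_ord[of "mdeg m"] by (auto simp: ord_ge_def)
      then show ?thesis by (simp add: E'_def sum.atLeast1_atMost_eq)
    qed
    ultimately show "\<exists>F. finite F \<and> F \<subseteq> {1..} \<and> (\<forall>n\<in>{1..} - F. coeff (word_gf n (\<lambda>_. True)) m = 0) \<and>
        coeff g m = coeff (\<Sum>n\<in>F. word_gf n (\<lambda>_. True)) m"
      by (intro exI[of _ ?F]) auto
  qed
qed

end

section \<open>Comparison of trees and words\<close>

text \<open>Here \<open>u\<close> and \<open>v\<close> stand for consecutive values of
  \<open>S\<close>, and \<open>iu\<close> and \<open>iv\<close> invert their denominators. Clearing
  the denominators leaves a polynomial identity.\<close>

lemma linear_step_of_bilinear_step:
  fixes u v x g l l' r r' iu iv :: "'a::comm_ring_1"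
  defines "A \<equiv> l' * r' * g + l' + r'" and "D \<equiv> l * r * g + l + r"
  assumes step: "v - u = x * ((1 + l' * v + l * (g - v)) * (1 + r * u + r' * (g - u)))"
    and iu: "(1 + (l * g + (l' - l) * u)) * iu = 1"
    and iv: "(1 + (l * g + (l' - l) * v)) * iv = 1"
  shows "(1 + l' * g) * v * iv - (1 + l' * g) * u * iu =
    x * (1 + A * g - (A - D) * ((1 + l' * g) * u * iu))" (is "?L = ?R")
proof -
  define p q where "p = 1 + (l * g + (l' - l) * u)" and "q = 1 + (l * g + (l' - l) * v)"
  have "?L * (p * q) = (1 + l' * g) * (v * p * (q * iv) - u * q * (p * iu))"
    by (simp add: algebra_simps)
  also have "\<dots> = (1 + l' * g) * (v * p - u * q)"
    using iu iv by (simp add: p_def q_def)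
  also have "v * p - u * q = (v - u) * (1 + l * g)"
    by (simp add: p_def q_def algebra_simps)
  \<comment> \<open>The first factor of \<open>step\<close> is exactly the denominator
    \<open>q\<close>, so \<open>v\<close> cancels from the right-hand side.\<close>
  also have "v - u = x * (q * (1 + r * u + r' * (g - u)))"
    unfolding step by (simp add: q_def algebra_simps)
  \<comment> \<open>This rests on \<open>1 + A * g = (1 + l' * g) * (1 + r' * g)\<close> and
    \<open>(r - r') * (1 + l * g) = (l' - l) * (1 + r' * g) - (A - D)\<close>.\<close>
  also have "(1 + l' * g) * (x * (q * (1 + r * u + r' * (g - u))) * (1 + l * g)) =
      x * q * ((1 + A * g) * p - (A - D) * (1 + l' * g) * u)"
    by (simp add: p_def A_def D_def algebra_simps)
  also have "\<dots> = x * q * ((1 + A * g) * p - (A - D) * (1 + l' * g) * u * (p * iu))"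
    using iu by (simp add: p_def)
  also have "\<dots> = ?R * (p * q)"
    by (simp add: algebra_simps)
  finally have "?L * (p * q) = ?R * (p * q)" .
  \<comment> \<open>The ring may have zero divisors, so \<open>p * q\<close> is cancelled through
    its inverse.\<close>
  moreover have "(p * q) * (iu * iv) = 1"
    using iu iv by (simp add: p_def q_def mult_ac) (metis mult.left_commute mult.right_neutral)
  ultimately show ?thesis by (metis mult.assoc mult.right_neutral)
qed

theorem theorem1p3:
  fixes G :: "(indet, 'c::comm_ring_1) mfps"
  defines "G \<equiv> tree_gf"
  shows "((\<lambda>n. \<Sum>\<alpha>\<in>compositions n.
            (lam_bar * rho_bar * G + lam_bar + rho_bar) ^ (n - length \<alpha>)
            * (lam * rho * G + lam + rho) ^ (length \<alpha> - 1)
            * ribbon \<alpha>) has_sum G) {1..}"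
proof -
  define S where "S k = (root_gf (\<lambda>b. b \<le> k) :: (indet, 'c) mfps)" for k
  have ord: "ord_ge 1 (S k)" "ord_ge 1 G" for k
    unfolding S_def G_def root_gf_True[symmetric] by (rule ord_ge_root_gf)+
  \<comment> \<open>The denominators of the change of variable are 1 plus a series of order at least
    1, hence units.\<close>
  have "\<forall>k. \<exists>i. (1 + (lam * G + (lam_bar - lam) * S k)) * i = 1"
    by (intro allI mfps_unit ord_ge_add ord_ge_mult_right ord)
  then obtain i where i: "\<And>k. (1 + (lam * G + (lam_bar - lam) * S k)) * i k = 1"
    by metis
  define W where "W k = (1 + lam_bar * G) * S k * i k" for k
  have "((\<lambda>n. word_gf (lam_bar * rho_bar * G + lam_bar + rho_bar) (lam * rho * G + lam + rho) n
      (\<lambda>_. True)) has_sum G) {1..}"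
  proof (rule has_sum_word_gf_of_recurrence)
    show "W 0 = 0" by (simp add: W_def S_def root_gf_le_0[simplified])
    show "ord_ge 1 (W k)" for k
      unfolding W_def by (subst mult.commute) (intro ord_ge_mult_right ord)
    show "W \<longlonglongrightarrow> G"
    proof (rule tendsto_mfps_mult_diff)
      show "S \<longlonglongrightarrow> G" unfolding S_def G_def by (rule root_gf_tendsto)
      \<comment> \<open>The change of variable fixes \<open>G\<close>, so \<open>S k - G\<close>
        divides \<open>W k - G\<close>; writing \<open>G\<close> over the denominator of
        \<open>W k\<close> exhibits the cofactor.\<close>
      show "W k - G = (S k - G) * ((1 + lam * G) * i k)" for k
      proof -
        have "W k - G = W k - G * ((1 + (lam * G + (lam_bar - lam) * S k)) * i k)"
          by (simp add: i)
        also have "\<dots> = (S k - G) * ((1 + lam * G) * i k)"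
          by (simp add: W_def algebra_simps)
        finally show ?thesis .
      qed
    qed
    show "W (Suc k) - W k = x_var (Suc k) *
      (1 + (lam_bar * rho_bar * G + lam_bar + rho_bar) * G -
       (lam_bar * rho_bar * G + lam_bar + rho_bar - (lam * rho * G + lam + rho)) * W k)" for k
      unfolding W_def using root_gf_step[of k, where 'c = 'c]
      by (intro linear_step_of_bilinear_step i) (simp add: S_def G_def)
  qed
  then show ?thesis by (simp add: word_gf_True)
qed

end
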